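(* Let $\nu_0=n-\nu_1-\cdots-\nu_p$ and write $\widehat R_0(\lambda)=\mathcal R(\lambda)$. Problem 2A (stated in the context) is solvable if and only if $$\dim\Big(\sum_{(i,j)\in P}\operatorname{span}_{\mathbb R}\widehat R_i(\lambda_{i,j})\Big)\ge\operatorname{card}P$$ for all $P$ in the power set $2^I$, where $I=\{(0,1),\ldots,(0,\nu_0),(1,1),\ldots,(1,\nu_1),\ldots,(p,1),\ldots,(p,\nu_p)\}$.
   Context: System: $\Sigma=(A,B,C,D)$ is $\mathcal D x=Ax+Bu$, $y=Cx+Du$, $x(t)\in\mathbb R^n$, $u(t)\in\mathbb R^m$, $y(t)\in\mathbb R^p$, real matrices; $\mathcal D x=\dot x$ (continuous time) or $x(t+1)$ (discrete time). $\mathbb C_g$ is the open left half-plane (continuous) or open unit disc (discrete), $\mathbb R_g=\mathbb C_g\cap\mathbb R$. Invariant zeros of $\Sigma$ are those $\lambda\in\mathbb C$ at which the rank of $\begin{bmatrix}A-\lambda I&B\\C&D\end{bmatrix}$ is below its normal rank; minimum-phase zeros are those in $\mathbb C_g$. Standing assumptions: $\Sigma$ is right invertible (that matrix pencil has full row rank for all but finitely many $\lambda$), stabilizable, with no invariant zero at $0$ (continuous) or $1$ (discrete); algebraic and geometric multiplicities of each minimum-phase invariant zero coincide; no Jordan chains are allowed in the closed loop ($A+BF$ diagonalizable); in this part all closed-loop eigenvalues considered and all minimum-phase invariant zeros are real. Control: $u=Fx+Gr$, $F$ real with $\sigma(A+BF)\subset\mathbb C_g$, $G$ a right inverse of the closed-loop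 static gain. For constant $r$, $\epsilon=y-r$ satisfies $\mathcal D\xi=(A+BF)\xi$, $\epsilon=(C+DF)\xi$. State-to-output decoupling: for any initial condition, $\epsilon_i(t)=\sum_{j=1}^{\nu_i}\beta_{i,j}e^{\lambda_{i,j}t}$ (resp. $\sum_j\beta_{i,j}\lambda_{i,j}^t$), $i=1,\ldots,p$, where the $\lambda_{i,j}$ are the observable closed-loop eigenvalues and the coefficients $\beta_{i,j}$ can be made arbitrary by choice of $\xi(0)$. That is, $A+BF$ has a basis of eigenvectors $v_{0,1},\ldots,v_{0,\nu_0},v_{1,1},\ldots,v_{p,\nu_p}$ with eigenvalues $\lambda_{i,j}$ such that $(C+DF)v_{0,j}=0$ and $(C+DF)v_{i,j}$ is a nonzero multiple of the $i$-th canonical vector $e_i\in\mathbb R^p$ for $i\ge1$; the $\lambda_{i,j}$ ($1\le j\le\nu_i$) are the eigenvalues observable from $\epsilon_i$ and the $\lambda_{0,j}$ the unobservable ones (all counted with multiplicity). Problem 2A: given nonnegative integers $\nu_1,\ldots,\nu_p$ with $\nu_0=n-\sum_i\nu_i\ge0$, and assigned $\lambda_{i,j}\in\mathbb R_g$ ($i=0,\ldots,p$, $j=1,\ldots,\nu_i$), all of which are allowed to be minimum-phase invariant zeros, find $F,G$ such that: (1) $y(t)\to\bar r$ for every constant reference $r(t)=\bar r$; (2) state-to-output decoupling is achieved; (3) from each $\epsilon_i$ exactly $\nu_i$ eigenvalues are observable; and the eigenvalues observable from $\epsilon_i$ are exactly $\{\lambda_{i,j}\}_{j=1,\ldots,\nu_i}$,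 the unobservable ones are $\{\lambda_{0,j}\}_{j=1,\ldots,\nu_0}$. Solvable means such $F,G$ exist. Sets, for real $\lambda$: $\mathcal R(\lambda)=\{v\in\mathbb R^n\mid\exists w\in\mathbb R^m:\ (A-\lambda I)v+Bw=0,\ Cv+Dw=0\}$; for $i\in\{1,\ldots,p\}$, $\widehat R_i(\lambda)=\{v\in\mathbb R^n\mid\exists w\in\mathbb R^m,\ \exists\delta\in\mathbb R\setminus\{0\}:\ (A-\lambda I)v+Bw=0,\ Cv+Dw=\delta e_i\}$. *)

theory Defs
  imports "HOL-Analysis.Analysis" "HOL-Computational_Algebra.Computational_Algebra"
    "HOL-Computational_Algebra.Field_as_Ring"
begin

(* A system with n states, m inputs and p outputs has A :: real^'n^'n, B :: real^'m^'n,
   C :: real^'n^'p, D :: real^'m^'p; the outputs 1, ..., p are the elements of 'p. *)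

datatype time_domain = Continuous | Discrete

definition stab_region :: "time_domain \<Rightarrow> complex set" where
  "stab_region td = (case td of Continuous \<Rightarrow> {z. Re z < 0} | Discrete \<Rightarrow> {z. cmod z < 1})"

definition spectrum :: "real^'n^'n \<Rightarrow> complex set" where
  "spectrum M = {z. \<exists>v. v \<noteq> 0 \<and> map_matrix complex_of_real M *v v = z *s v}"

definition stabilizable :: "time_domain \<Rightarrow> real^'n^'n \<Rightarrow> real^'m^'n \<Rightarrow> bool" where
  "stabilizable td A B \<longleftrightarrow> (\<exists>F :: real^'n^'m. spectrum (A + B ** F) \<subseteq> stab_region td)"

(* The pencil [A - s I, B; C, D] with entries polynomials in s. *)
definition system_pencil ::
    "real^'n^'n \<Rightarrow> real^'m^'n \<Rightarrow> real^'n^'p \<Rightarrow> real^'m^'p \<Rightarrow> (complex poly)^('n + 'm)^('n + 'p)" where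
  "system_pencil A B C D = (\<chi> r c.
     (case r of
        Inl i \<Rightarrow> (case c of
            Inl j \<Rightarrow> [:complex_of_real (A $ i $ j), if i = j then - 1 else 0:]
          | Inr k \<Rightarrow> [:complex_of_real (B $ i $ k):])
      | Inr q \<Rightarrow> (case c of
            Inl j \<Rightarrow> [:complex_of_real (C $ q $ j):]
          | Inr k \<Rightarrow> [:complex_of_real (D $ q $ k):])))"

definition eval_pencil :: "(complex poly)^'c^'r \<Rightarrow> complex \<Rightarrow> complex^'c^'r" where
  "eval_pencil P z = map_matrix (\<lambda>q. poly q z) P"

definition normal_rank :: "(complex poly)^'c^'r \<Rightarrow> nat" where
  "normal_rank P = Max (range (\<lambda>z. rank (eval_pencil P z)))"

definition right_invertible ::
    "real^'n^'n \<Rightarrow> real^'m^'n \<Rightarrow> real^'n^'p \<Rightarrow> real^'m^'p \<Rightarrow> bool" where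
  "right_invertible A B C D \<longleftrightarrow>
     finite {z. rank (eval_pencil (system_pencil A B C D) z) \<noteq> CARD('n + 'p)}"

definition invariant_zero ::
    "real^'n^'n \<Rightarrow> real^'m^'n \<Rightarrow> real^'n^'p \<Rightarrow> real^'m^'p \<Rightarrow> complex \<Rightarrow> bool" where
  "invariant_zero A B C D z \<longleftrightarrow>
     rank (eval_pencil (system_pencil A B C D) z) < normal_rank (system_pencil A B C D)"

(* The minor of order r with rows f 0, ..., f (r - 1) and columns g 0, ..., g (r - 1),
   by the Leibniz formula. *)
definition minor :: "('a::comm_ring_1)^'c^'r \<Rightarrow> nat \<Rightarrow> (nat \<Rightarrow> 'r) \<Rightarrow> (nat \<Rightarrow> 'c) \<Rightarrow> 'a" where
  "minor P r f g =
     (\<Sum>\<pi> | \<pi> permutes {..<r}. of_int (sign \<pi>) * (\<Prod>k<r. P $ f k $ g (\<pi> k)))"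

(* The product of the invariant polynomials (the nonzero diagonal entries of the Smith form)
   equals the gcd of all minors whose order is the normal rank.  Selections f, g that are not
   increasing on {..<r} only contribute 0 or minors up to sign, which do not affect the gcd. *)
definition zero_polynomial ::
    "real^'n^'n \<Rightarrow> real^'m^'n \<Rightarrow> real^'n^'p \<Rightarrow> real^'m^'p \<Rightarrow> complex poly" where
  "zero_polynomial A B C D =
     (let P = system_pencil A B C D in Gcd {minor P (normal_rank P) f g | f g. True})"

definition algebraic_mult ::
    "real^'n^'n \<Rightarrow> real^'m^'n \<Rightarrow> real^'n^'p \<Rightarrow> real^'m^'p \<Rightarrow> complex \<Rightarrow> nat" where
  "algebraic_mult A B C D z = order z (zero_polynomial A B C D)"

definition geometric_mult ::
    "real^'n^'n \<Rightarrow> real^'m^'n \<Rightarrow> real^'n^'p \<Rightarrow> real^'m^'p \<Rightarrow> complex \<Rightarrow> nat" where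
  "geometric_mult A B C D z =
     normal_rank (system_pencil A B C D) - rank (eval_pencil (system_pencil A B C D) z)"

definition standing_assumptions ::
    "time_domain \<Rightarrow> real^'n^'n \<Rightarrow> real^'m^'n \<Rightarrow> real^'n^'p \<Rightarrow> real^'m^'p \<Rightarrow> bool" where
  "standing_assumptions td A B C D \<longleftrightarrow>
     right_invertible A B C D \<and>
     stabilizable td A B \<and>
     \<not> invariant_zero A B C D (case td of Continuous \<Rightarrow> 0 | Discrete \<Rightarrow> 1) \<and>
     (\<forall>z \<in> stab_region td. invariant_zero A B C D z \<longrightarrow>
        algebraic_mult A B C D z = geometric_mult A B C D z \<and> z \<in> \<real>)"

(* Steady-state gain from the input v to the output y of D x = M x + B v, y = N x + D v. *)
definition static_gain ::
    "time_domain \<Rightarrow> real^'n^'n \<Rightarrow> real^'m^'n \<Rightarrow> real^'n^'p \<Rightarrow> real^'m^'p \<Rightarrow> real^'m^'p" where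
  "static_gain td M B N D =
     (case td of
        Continuous \<Rightarrow> N ** matrix_inv (- M) ** B + D
      | Discrete \<Rightarrow> N ** matrix_inv (mat 1 - M) ** B + D)"

definition ct_trajectory ::
    "real^'n^'n \<Rightarrow> real^'m^'n \<Rightarrow> (real \<Rightarrow> real^'m) \<Rightarrow> (real \<Rightarrow> real^'n) \<Rightarrow> bool" where
  "ct_trajectory A B u x \<longleftrightarrow>
     (\<forall>t\<ge>0. (x has_vector_derivative (A *v x t + B *v u t)) (at t within {0..}))"

definition dt_trajectory ::
    "real^'n^'n \<Rightarrow> real^'m^'n \<Rightarrow> (nat \<Rightarrow> real^'m) \<Rightarrow> (nat \<Rightarrow> real^'n) \<Rightarrow> bool" where
  "dt_trajectory A B u x \<longleftrightarrow> (\<forall>t. x (Suc t) = A *v x t + B *v u t)"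

(* Under u = F x + G r, y(t) tends to r for every constant r and every initial state. *)
definition tracks_constant_references ::
    "time_domain \<Rightarrow> real^'n^'n \<Rightarrow> real^'m^'n \<Rightarrow> real^'n^'p \<Rightarrow> real^'m^'p
       \<Rightarrow> real^'n^'m \<Rightarrow> real^'p^'m \<Rightarrow> bool" where
  "tracks_constant_references td A B C D F G \<longleftrightarrow>
     (case td of
        Continuous \<Rightarrow>
          (\<forall>r x u. (\<forall>t. u t = F *v x t + G *v r) \<and> ct_trajectory A B u x \<longrightarrow>
             ((\<lambda>t. C *v x t + D *v u t) \<longlongrightarrow> r) at_top)
      | Discrete \<Rightarrow>
          (\<forall>r x u. (\<forall>t. u t = F *v x t + G *v r) \<and> dt_trajectory A B u x \<longrightarrow>
             (\<lambda>t. C *v x t + D *v u t) \<longlonglongrightarrow> r))"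

(* The index i ranges over 'p option: None stands for i = 0 (unobservable modes) and
   Some i for the output i.  mode_index \<nu> is the set I of pairs (i, j) with 1 \<le> j \<le> \<nu> i. *)
definition mode_index :: "('p::finite option \<Rightarrow> nat) \<Rightarrow> ('p option \<times> nat) set" where
  "mode_index \<nu> = {(i, j). 1 \<le> j \<and> j \<le> \<nu> i}"

(* For M = A + B F and N = C + D F: a basis of R^n consisting of eigenvectors of M with the
   eigenvalues lam i j, such that N annihilates those with i = 0 and maps those with i \<ge> 1
   to nonzero multiples of the canonical vector e_i. *)
definition decoupling_eigenbasis ::
    "real^'n^'n \<Rightarrow> real^'n^'p \<Rightarrow> ('p option \<Rightarrow> nat) \<Rightarrow> ('p option \<Rightarrow> nat \<Rightarrow> real)
       \<Rightarrow> ('p option \<Rightarrow> nat \<Rightarrow> real^'n) \<Rightarrow> bool" where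
  "decoupling_eigenbasis M N \<nu> lam v \<longleftrightarrow>
     inj_on (\<lambda>(i, j). v i j) (mode_index \<nu>) \<and>
     independent ((\<lambda>(i, j). v i j) ` mode_index \<nu>) \<and>
     span ((\<lambda>(i, j). v i j) ` mode_index \<nu>) = UNIV \<and>
     (\<forall>(i, j) \<in> mode_index \<nu>. M *v v i j = lam i j *\<^sub>R v i j) \<and>
     (\<forall>j. (None, j) \<in> mode_index \<nu> \<longrightarrow> N *v v None j = 0) \<and>
     (\<forall>i j. (Some i, j) \<in> mode_index \<nu> \<longrightarrow>
        (\<exists>\<delta>. \<delta> \<noteq> 0 \<and> N *v v (Some i) j = \<delta> *\<^sub>R axis i 1))"

(* Modal form of the tracking error eps = N xi, where D xi = M xi: each eps_i is a combination
   of the modes lam (Some i) j, and all combinations occur. *)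
definition decoupled_error_modes ::
    "time_domain \<Rightarrow> real^'n^'n \<Rightarrow> real^'n^'p \<Rightarrow> ('p option \<Rightarrow> nat)
       \<Rightarrow> ('p option \<Rightarrow> nat \<Rightarrow> real) \<Rightarrow> bool" where
  "decoupled_error_modes td M N \<nu> lam \<longleftrightarrow>
     (case td of
        Continuous \<Rightarrow>
          (let free = (\<lambda>\<xi>. \<forall>t\<ge>0. (\<xi> has_vector_derivative (M *v \<xi> t)) (at t within {0..}));
               modal = (\<lambda>\<xi> \<beta>. \<forall>i. \<forall>t\<ge>0. (N *v \<xi> t) $ i =
                          (\<Sum>j = 1..\<nu> (Some i). \<beta> i j * exp (lam (Some i) j * t)))
           in (\<forall>\<xi>. free \<xi> \<longrightarrow> (\<exists>\<beta>. modal \<xi> \<beta>)) \<and> (\<forall>\<beta>. \<exists>\<xi>. free \<xi> \<and> modal \<xi> \<beta>))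
      | Discrete \<Rightarrow>
          (let free = (\<lambda>\<xi>. \<forall>t::nat. \<xi> (Suc t) = M *v \<xi> t);
               modal = (\<lambda>\<xi> \<beta>. \<forall>i. \<forall>t::nat. (N *v \<xi> t) $ i =
                          (\<Sum>j = 1..\<nu> (Some i). \<beta> i j * lam (Some i) j ^ t))
           in (\<forall>\<xi>. free \<xi> \<longrightarrow> (\<exists>\<beta>. modal \<xi> \<beta>)) \<and> (\<forall>\<beta>. \<exists>\<xi>. free \<xi> \<and> modal \<xi> \<beta>)))"

definition state_output_decoupled ::
    "time_domain \<Rightarrow> real^'n^'n \<Rightarrow> real^'n^'p \<Rightarrow> ('p option \<Rightarrow> nat)
       \<Rightarrow> ('p option \<Rightarrow> nat \<Rightarrow> real) \<Rightarrow> bool" where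
  "state_output_decoupled td M N \<nu> lam \<longleftrightarrow>
     decoupled_error_modes td M N \<nu> lam \<and> (\<exists>v. decoupling_eigenbasis M N \<nu> lam v)"

(* The number of modes observable from each error component and the assigned eigenvalues enter
   through the data \<nu>, lam of state_output_decoupled. *)
definition problem_2A_solvable ::
    "time_domain \<Rightarrow> real^'n^'n \<Rightarrow> real^'m^'n \<Rightarrow> real^'n^'p \<Rightarrow> real^'m^'p
       \<Rightarrow> ('p option \<Rightarrow> nat) \<Rightarrow> ('p option \<Rightarrow> nat \<Rightarrow> real) \<Rightarrow> bool" where
  "problem_2A_solvable td A B C D \<nu> lam \<longleftrightarrow>
     (\<exists>(F :: real^'n^'m) (G :: real^'p^'m).
        spectrum (A + B ** F) \<subseteq> stab_region td \<and>
        static_gain td (A + B ** F) B (C + D ** F) D ** G = mat 1 \<and>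
        tracks_constant_references td A B C D F G \<and>
        state_output_decoupled td (A + B ** F) (C + D ** F) \<nu> lam)"

definition R_set ::
    "real^'n^'n \<Rightarrow> real^'m^'n \<Rightarrow> real^'n^'p \<Rightarrow> real^'m^'p \<Rightarrow> real \<Rightarrow> (real^'n) set" where
  "R_set A B C D l =
     {v. \<exists>w :: real^'m. (A - mat l) *v v + B *v w = 0 \<and> C *v v + D *v w = 0}"

definition R_hat ::
    "real^'n^'n \<Rightarrow> real^'m^'n \<Rightarrow> real^'n^'p \<Rightarrow> real^'m^'p \<Rightarrow> 'p option \<Rightarrow> real \<Rightarrow> (real^'n) set" where
  "R_hat A B C D i l =
     (case i of
        None \<Rightarrow> R_set A B C D l
      | Some k \<Rightarrow> {v. \<exists>(w :: real^'m) \<delta>. \<delta> \<noteq> 0 \<and>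
                     (A - mat l) *v v + B *v w = 0 \<and> C *v v + D *v w = \<delta> *\<^sub>R axis k 1})"

end

theory Submission
  imports Defs
begin

unbundle no fps_syntax

text \<open>
  A feedback \<open>F\<close> solves the problem exactly if \<open>A + B F\<close> has an eigenbasis whose \<open>(i, j)\<close>-th vector
  lies in \<open>R_hat i (lam i j)\<close>: membership provides an input direction \<open>w\<close>, and \<open>F\<close> is defined by
  sending each basis vector to its \<open>w\<close>. So the question is whether the family of sets
  \<open>R_hat i (lam i j)\<close> has a linearly independent transversal, which Rado's theorem decides by the
  stated dimension condition. The precompensator \<open>G\<close> exists because the system pencil has full row
  rank at \<open>0\<close> (continuous time) or \<open>1\<close> (discrete time).
\<close>

subsection \<open>Rado's theorem\<close>

text \<open>Ranks are measured relative to \<open>S\<close>, which stands in for passing to a quotient space: a subfamily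
  meeting its rank bound with equality is moved into \<open>S\<close>, as in the proof of Hall's theorem.\<close>

lemma rado_relative:
  fixes A :: "'k \<Rightarrow> 'a::euclidean_space set"
  assumes "finite I"
    and "\<And>P. P \<subseteq> I \<Longrightarrow> dim S + card P \<le> dim (S \<union> (\<Union>k\<in>P. A k))"
  shows "\<exists>v. (\<forall>k\<in>I. v k \<in> A k) \<and> dim S + card I \<le> dim (S \<union> v ` I)"
  using assms
proof (induction "card I" arbitrary: I S rule: less_induct)
  case less
  note fin = less.prems(1) and rank = less.prems(2)
  show ?case
  proof (cases "I = {}")
    case True
    then show ?thesis by simp
  next
    case False
    show ?thesis
    proof (cases "\<exists>P. P \<subseteq> I \<and> P \<noteq> {} \<and> P \<noteq> I \<and> dim (S \<union> (\<Union>k\<in>P. A k)) = dim S + card P")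
      case True
      then obtain P where P: "P \<subseteq> I" "P \<noteq> {}" "P \<noteq> I"
        and tight: "dim (S \<union> (\<Union>k\<in>P. A k)) = dim S + card P" by blast
      have finP: "finite P" using P fin finite_subset by blast
      let ?T = "S \<union> (\<Union>k\<in>P. A k)"
      have cardI: "card I = card P + card (I - P)"
        using P fin by (simp add: card_Diff_subset card_mono finP)
      have ltP: "card P < card I" using P fin by (simp add: psubset_card_mono psubsetI)
      have "\<exists>v. (\<forall>k\<in>P. v k \<in> A k) \<and> dim S + card P \<le> dim (S \<union> v ` P)"
        using less.hyps[OF ltP finP] rank P(1) by (meson order_trans)
      then obtain v where v: "\<forall>k\<in>P. v k \<in> A k" "dim S + card P \<le> dim (S \<union> v ` P)" by blast
      \<comment> \<open>By tightness the chosen vectors already reach the full dimension of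
        \<open>?T\<close>. The remaining indices can thus be treated relative to \<open>?T\<close>
        and the result read back relative to \<open>S\<close> and these vectors.\<close>
      have span_eq: "span (S \<union> v ` P) = span ?T"
      proof (rule subspace_dim_equal)
        show "span (S \<union> v ` P) \<subseteq> span ?T" using v(1) by (intro span_mono) blast
        show "dim (span ?T) \<le> dim (span (S \<union> v ` P))" using v(2) tight by simp
      qed auto
      \<comment> \<open>The bound for \<open>P \<union> Q\<close> minus the equality for
        \<open>P\<close> leaves the bound for \<open>Q\<close> over the enlarged base.\<close>
      have rank': "dim ?T + card Q \<le> dim (?T \<union> (\<Union>k\<in>Q. A k))" if Q: "Q \<subseteq> I - P" for Q
      proof -
        have "dim S + card (P \<union> Q) \<le> dim (S \<union> (\<Union>k\<in>P \<union> Q. A k))"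
          using Q P(1) by (intro rank) blast
        moreover have "card (P \<union> Q) = card P + card Q"
          using Q fin finP by (intro card_Un_disjoint) (auto intro: finite_subset)
        ultimately show ?thesis using tight by (simp add: UN_Un Un_assoc)
      qed
      have "card (I - P) < card I"
        using cardI P(2) finP by (simp add: card_gt_0_iff)
      then have "\<exists>v. (\<forall>k\<in>I - P. v k \<in> A k) \<and> dim ?T + card (I - P) \<le> dim (?T \<union> v ` (I - P))"
        using less.hyps[of "I - P" ?T] rank' fin by blast
      then obtain u where u: "\<forall>k\<in>I - P. u k \<in> A k" "dim ?T + card (I - P) \<le> dim (?T \<union> u ` (I - P))"
        by blast
      define w where "w k = (if k \<in> P then v k else u k)" for k
      have w_im: "w ` I = v ` P \<union> u ` (I - P)"
        using P(1) by (auto simp: w_def image_iff)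
      have "span (?T \<union> u ` (I - P)) = span ((S \<union> v ` P) \<union> u ` (I - P))"
        by (simp only: span_Un[of ?T] span_Un[of "S \<union> v ` P"] span_eq)
      then have "dim (?T \<union> u ` (I - P)) = dim ((S \<union> v ` P) \<union> u ` (I - P))"
        by (rule span_eq_dim)
      then have "dim S + card I \<le> dim (S \<union> w ` I)"
        using u(2) tight cardI by (simp add: w_im Un_assoc)
      moreover have "\<forall>k\<in>I. w k \<in> A k" using u v by (simp add: w_def)
      ultimately show ?thesis by blast
    next
      case no_tight: False
      \<comment> \<open>Every nonempty proper subfamily now has a spare dimension. Moving one vector
        \<open>x\<close> of \<open>A i\<close> outside \<open>span S\<close> into the base raises
        its dimension by one, which this slack absorbs.\<close>
      obtain i where i: "i \<in> I" using False by blast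
      have "dim S + 1 \<le> dim (S \<union> A i)" using rank[of "{i}"] i by simp
      then have "\<not> A i \<subseteq> span S"
        by (metis Suc_eq_plus1 Un_least dim_span dim_subset not_less_eq_eq span_superset order_refl)
      then obtain x where x: "x \<in> A i" "x \<notin> span S" by blast
      have dimx: "dim (insert x S) = dim S + 1" using x by (simp add: dim_insert)
      have rank': "dim (insert x S) + card Q \<le> dim (insert x S \<union> (\<Union>k\<in>Q. A k))"
        if Q: "Q \<subseteq> I - {i}" for Q
      proof (cases "Q = {}")
        case False
        then have "dim (S \<union> (\<Union>k\<in>Q. A k)) \<noteq> dim S + card Q" using no_tight Q i by blast
        then have "dim S + card Q + 1 \<le> dim (S \<union> (\<Union>k\<in>Q. A k))"
          using rank[of Q] Q by force
        also have "\<dots> \<le> dim (insert x S \<union> (\<Union>k\<in>Q. A k))" by (intro dim_subset) blast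
        finally show ?thesis using dimx by simp
      qed simp
      have "card (I - {i}) < card I" using i fin by (meson card_Diff1_less)
      then obtain u where u: "\<forall>k\<in>I - {i}. u k \<in> A k"
          "dim (insert x S) + card (I - {i}) \<le> dim (insert x S \<union> u ` (I - {i}))"
        using less.hyps[of "I - {i}" "insert x S"] rank' fin by blast
      have "insert x S \<union> u ` (I - {i}) = S \<union> (u(i := x)) ` I" using i by auto
      then have "dim S + card I \<le> dim (S \<union> (u(i := x)) ` I)"
        using u(2) dimx i fin by (simp add: card_Suc_Diff1 card_Diff_singleton)
      moreover have "\<forall>k\<in>I. (u(i := x)) k \<in> A k" using u(1) x(1) by simp
      ultimately show ?thesis by blast
    qed
  qed
qed

text \<open>With an empty base the chain card I \<le> dim \<le> number of chosen vectors \<le> card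
  I collapses to equalities, which give independence and injectivity together.\<close>

lemma rado:
  fixes A :: "'k \<Rightarrow> 'a::euclidean_space set"
  assumes "finite I" and "\<And>P. P \<subseteq> I \<Longrightarrow> card P \<le> dim (\<Union>k\<in>P. A k)"
  obtains v where "\<And>k. k \<in> I \<Longrightarrow> v k \<in> A k" "inj_on v I" "independent (v ` I)"
proof -
  obtain v where v: "\<forall>k\<in>I. v k \<in> A k" "card I \<le> dim (v ` I)"
    using rado_relative[of I "{}" A] assms by auto
  have "dim (v ` I) \<le> card (v ` I)" using assms(1) by (simp add: dim_le_card')
  moreover have "card (v ` I) \<le> card I" using assms(1) by (rule card_image_le)
  ultimately have "card (v ` I) = card I" "card (v ` I) = dim (v ` I)" using v(2) by auto
  then have "inj_on v I" "independent (v ` I)"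
    using assms(1) card_eq_dim[of "v ` I" "v ` I"] by (auto intro: eq_card_imp_inj_on simp: span_superset)
  then show ?thesis using that v(1) by blast
qed

text \<open>Translates the elementwise sum of subspaces in the solvability criterion into the union
  on which Rado's condition is stated.\<close>

lemma sum_span_eq_span_Union:
  fixes f :: "'k \<Rightarrow> 'a::real_vector set"
  assumes "finite P"
  shows "(\<Sum>k\<in>P. span (f k)) = span (\<Union>k\<in>P. f k)"
  using assms
proof (induction P)
  case (insert a P)
  then show ?case by (auto simp: span_Un set_plus_def)
qed simp

subsection \<open>The index set of modes\<close>

lemma sum_UNIV_option:
  fixes h :: "'p::finite option \<Rightarrow> 'b::comm_monoid_add"
  shows "sum h UNIV = h None + (\<Sum>i\<in>UNIV. h (Some i))"
  by (simp add: UNIV_option_conv sum.reindex)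

lemma mode_index_eq_Sigma: "mode_index \<nu> = (SIGMA i:UNIV. {1..\<nu> i})"
  by (auto simp: mode_index_def)

lemma finite_mode_index: "finite (mode_index \<nu>)"
  by (simp add: mode_index_eq_Sigma)

lemma card_mode_index: "card (mode_index \<nu>) = \<nu> None + (\<Sum>i\<in>UNIV. \<nu> (Some i))"
  by (simp add: mode_index_eq_Sigma sum_UNIV_option)

lemma sum_mode_index:
  "sum g (mode_index \<nu>) =
    (\<Sum>j = 1..\<nu> None. g (None, j)) + (\<Sum>i\<in>UNIV. \<Sum>j = 1..\<nu> (Some i). g (Some i, j))"
proof -
  have "sum g (mode_index \<nu>) = (\<Sum>i\<in>UNIV. \<Sum>j = 1..\<nu> i. g (i, j))"
    unfolding mode_index_eq_Sigma by (subst sum.Sigma) (auto simp: case_prod_beta)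
  then show ?thesis by (simp only: sum_UNIV_option)
qed

subsection \<open>Full row rank of the system pencil\<close>

lemma rank_le_nrows: "rank (M :: 'a::field^'c^'r) \<le> CARD('r)"
proof -
  have "rows M = range (\<lambda>i. row i M)" by (auto simp: rows_def)
  then have "vec.dim (rows M) \<le> card (range (\<lambda>i. row i M))" by (simp add: vec.dim_le_card')
  also have "\<dots> \<le> CARD('r)" by (simp add: card_image_le)
  finally show ?thesis by (simp add: row_rank_def_gen)
qed

text \<open>The dimension of the set of rows can equal the number of row indices only if the rows
  are distinct and independent. Distinctness lets \<open>inv ?r\<close> carry the coefficients from
  indices over to row vectors.\<close>

lemma full_row_rank_kernel:
  fixes M :: "'a::field^'c^'r"
  assumes "rank M = CARD('r)" and "\<And>j. (\<Sum>i\<in>UNIV. c i * M $ i $ j) = 0"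
  shows "c i = 0"
proof -
  let ?r = "\<lambda>i. row i M"
  have rows: "rows M = range ?r" by (auto simp: rows_def)
  have "vec.dim (range ?r) = CARD('r)" using assms(1) rows by (simp add: row_rank_def_gen)
  moreover have "vec.dim (range ?r) \<le> card (range ?r)" by (simp add: vec.dim_le_card')
  moreover have "card (range ?r) \<le> CARD('r)" by (simp add: card_image_le)
  ultimately have card: "card (range ?r) = CARD('r)" "card (range ?r) = vec.dim (range ?r)" by auto
  have inj: "inj ?r" using card(1) by (auto intro: eq_card_imp_inj_on)
  have ind: "vec.independent (range ?r)"
    using card(2) vec.card_eq_dim[of "range ?r" "range ?r"] by (auto simp: vec.span_superset)
  have "(\<Sum>i\<in>UNIV. c i *s ?r i) = 0"
    using assms(2) by (simp add: vec_eq_iff row_def)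
  then have "(\<Sum>x\<in>range ?r. c (inv ?r x) *s x) = 0"
    using inj by (simp add: sum.reindex inv_f_f[OF inj])
  then have "c (inv ?r (?r i)) = 0"
    using ind vec.independentD[of "range ?r" "range ?r" "\<lambda>x. c (inv ?r x)" "?r i"] by simp
  then show ?thesis by (simp add: inv_f_f[OF inj])
qed

text \<open>Right invertibility leaves some point of full row rank, so the normal rank is at least
  the number of rows, and a point that is not an invariant zero attains it.\<close>

lemma system_pencil_full_row_rank:
  fixes A :: "real^'n^'n" and B :: "real^'m^'n" and C :: "real^'n^'p" and D :: "real^'m^'p"
  assumes "right_invertible A B C D" and "\<not> invariant_zero A B C D z"
  shows "rank (eval_pencil (system_pencil A B C D) z) = CARD('n + 'p)"
proof -
  let ?rk = "\<lambda>z. rank (eval_pencil (system_pencil A B C D) z)"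
  \<comment> \<open>The \<open>Max\<close> in \<open>normal_rank\<close> is an upper bound only over
    a finite set.\<close>
  have fin: "finite (range ?rk)"
  proof (rule finite_subset)
    show "range ?rk \<subseteq> {..CARD('n + 'p)}" using rank_le_nrows by blast
  qed simp
  have "{z. ?rk z \<noteq> CARD('n + 'p)} \<noteq> UNIV"
    using assms(1) infinite_UNIV_char_0[where 'a = complex] unfolding right_invertible_def by metis
  then obtain z0 where "?rk z0 = CARD('n + 'p)" by blast
  then have "CARD('n + 'p) \<le> normal_rank (system_pencil A B C D)"
    unfolding normal_rank_def using fin by (metis Max_ge rangeI)
  also have "\<dots> \<le> ?rk z" using assms(2) by (simp add: invariant_zero_def)
  finally show ?thesis using rank_le_nrows le_antisym by blast
qed

text \<open>Read over the complex numbers, \<open>x\<close> and \<open>y\<close> are the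
  coefficients of a vanishing combination of the rows of the pencil. In this form the rank condition
  is applied to the static gain.\<close>

lemma system_pencil_left_kernel:
  fixes A :: "real^'n^'n" and B :: "real^'m^'n" and C :: "real^'n^'p" and D :: "real^'m^'p"
  assumes rk: "rank (eval_pencil (system_pencil A B C D) (complex_of_real s)) = CARD('n + 'p)"
    and 1: "x v* (A - mat s) + y v* C = 0" and 2: "x v* B + y v* D = 0"
  shows "y = 0"
proof -
  define c :: "'n + 'p \<Rightarrow> complex"
    where "c = case_sum (\<lambda>i. complex_of_real (x $ i)) (\<lambda>q. complex_of_real (y $ q))"
  have split: "sum h UNIV = (\<Sum>i\<in>UNIV. h (Inl i)) + (\<Sum>q\<in>UNIV. h (Inr q))"
    for h :: "'n + 'p \<Rightarrow> complex"
    by (simp add: UNIV_Plus_UNIV[symmetric] sum.Plus del: UNIV_Plus_UNIV)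
  have "(\<Sum>r\<in>UNIV. c r * eval_pencil (system_pencil A B C D) (complex_of_real s) $ r $ col) = 0" for col
  proof (cases col)
    case (Inl j)
    have "(\<Sum>i\<in>UNIV. x $ i * (A - mat s) $ i $ j) + (\<Sum>q\<in>UNIV. y $ q * C $ q $ j) = 0"
      using arg_cong[OF 1, of "\<lambda>u. u $ j"] by (simp add: vector_matrix_mult_def mult.commute)
    then have "complex_of_real ((\<Sum>i\<in>UNIV. x $ i * (A - mat s) $ i $ j) + (\<Sum>q\<in>UNIV. y $ q * C $ q $ j)) = 0"
      by simp
    moreover have "complex_of_real (A $ i $ j) + complex_of_real s * (if i = j then - 1 else 0)
        = complex_of_real ((A - mat s) $ i $ j)" for i
      by (simp add: mat_def)
    ultimately show ?thesis
      by (simp add: split c_def eval_pencil_def system_pencil_def map_matrix_def Inl del: vector_minus_component)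
  next
    case (Inr k)
    have "(\<Sum>i\<in>UNIV. x $ i * B $ i $ k) + (\<Sum>q\<in>UNIV. y $ q * D $ q $ k) = 0"
      using arg_cong[OF 2, of "\<lambda>u. u $ k"] by (simp add: vector_matrix_mult_def mult.commute)
    then have "complex_of_real ((\<Sum>i\<in>UNIV. x $ i * B $ i $ k) + (\<Sum>q\<in>UNIV. y $ q * D $ q $ k)) = 0"
      by simp
    then show ?thesis
      by (simp add: split c_def eval_pencil_def system_pencil_def map_matrix_def Inr)
  qed
  then have "c (Inr q) = 0" for q by (rule full_row_rank_kernel[OF rk])
  then show ?thesis by (simp add: c_def vec_eq_iff)
qed

subsection \<open>Diagonalizable matrices in eigenvector coordinates\<close>

lemma mat_vector_mult: "mat s *v x = s *\<^sub>R x" for s :: real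
  by (simp add: vec_eq_iff matrix_vector_mult_def mat_def if_distrib if_distribR cong: if_cong)

text \<open>Eigenvectors are indexed by \<open>K\<close>, so that repeated values of
  \<open>l\<close> keep their multiplicity.\<close>

locale real_eigenbasis =
  fixes M :: "real^'n^'n" and K :: "'k set" and v :: "'k \<Rightarrow> real^'n" and l :: "'k \<Rightarrow> real"
  assumes finite_K: "finite K" and inj: "inj_on v K" and indep: "independent (v ` K)"
    and span: "span (v ` K) = UNIV"
    and eigen: "k \<in> K \<Longrightarrow> M *v v k = l k *\<^sub>R v k"
begin

lemma mult_combination: "M *v (\<Sum>k\<in>K. a k *\<^sub>R v k) = (\<Sum>k\<in>K. (a k * l k) *\<^sub>R v k)"
  by (simp add: linear_sum[OF matrix_vector_mul_linear] matrix_vector_mult_scaleR eigen)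

text \<open>The dual basis functional of \<open>v k\<close>. For \<open>k\<close> outside
  \<open>K\<close> the condition describes a functional vanishing on the whole basis, so a witness
  exists for every \<open>k\<close>.\<close>

definition coord :: "'k \<Rightarrow> real^'n \<Rightarrow> real" where
  "coord k = (SOME f. linear f \<and> (\<forall>j\<in>K. f (v j) = (if j = k then 1 else 0)))"

lemma coord: "linear (coord k)" "j \<in> K \<Longrightarrow> coord k (v j) = (if j = k then 1 else 0)"
proof -
  obtain g where "linear g" "\<forall>x\<in>v ` K. g x = (if inv_into K v x = k then 1 else 0 :: real)"
    using linear_independent_extend[OF indep, of "\<lambda>x. if inv_into K v x = k then 1 else 0 :: real"]
    by blast
  then have "linear g \<and> (\<forall>j\<in>K. g (v j) = (if j = k then 1 else 0))" using inj by simp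
  then have "\<exists>f. linear f \<and> (\<forall>j\<in>K. f (v j) = (if j = k then 1 else 0 :: real))" by blast
  then have "linear (coord k) \<and> (\<forall>j\<in>K. coord k (v j) = (if j = k then 1 else 0))"
    unfolding coord_def by (rule someI_ex)
  then show "linear (coord k)" "j \<in> K \<Longrightarrow> coord k (v j) = (if j = k then 1 else 0)" by auto
qed

lemmas coord_linear = linear_add[OF coord(1)] linear_diff[OF coord(1)] linear_scale[OF coord(1)]
  linear_sum[OF coord(1)]

lemma coord_combination:
  assumes "k \<in> K"
  shows "coord k (\<Sum>j\<in>K. a j *\<^sub>R v j) = a k"
proof -
  have "coord k (\<Sum>j\<in>K. a j *\<^sub>R v j) = (\<Sum>j\<in>K. a j * coord k (v j))"
    by (simp add: coord_linear)
  also have "\<dots> = (\<Sum>j\<in>K. if j = k then a j else 0)"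
    by (intro sum.cong) (auto simp: coord(2))
  also have "\<dots> = a k" using assms finite_K by simp
  finally show ?thesis .
qed

lemma coord_expand: "x = (\<Sum>k\<in>K. coord k x *\<^sub>R v k)"
proof (rule linear_eq_on_span[of "\<lambda>x. x" "\<lambda>x. \<Sum>k\<in>K. coord k x *\<^sub>R v k" "v ` K" x])
  show "linear (\<lambda>x. \<Sum>k\<in>K. coord k x *\<^sub>R v k)"
    by (rule linearI)
      (simp_all add: coord_linear scaleR_add_left sum.distrib scaleR_sum_right)
  show "x \<in> span (v ` K)" using span by simp
  show "y = (\<Sum>k\<in>K. coord k y *\<^sub>R v k)" if y: "y \<in> v ` K" for y
  proof -
    obtain j where j: "j \<in> K" "y = v j" using y by blast
    then have "(\<Sum>k\<in>K. coord k y *\<^sub>R v k) = (\<Sum>k\<in>K. if j = k then v k else 0)"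
      by (intro sum.cong) (auto simp: coord(2))
    then show ?thesis using j finite_K by simp
  qed
qed (rule linear_ident)

text \<open>The coordinate functionals are left eigenvectors of \<open>M\<close>; this reduces both
  the spectrum and the dynamics to scalar equations.\<close>

lemma coord_mult:
  assumes "k \<in> K"
  shows "coord k (M *v x) = l k * coord k x"
proof -
  have "M *v x = (\<Sum>j\<in>K. (coord j x * l j) *\<^sub>R v j)"
    using arg_cong[OF coord_expand, of "\<lambda>y. M *v y" x] mult_combination by (rule trans)
  then show ?thesis using coord_combination[OF assms] by (simp add: mult.commute)
qed

lemma coord_zero:
  assumes "\<And>k. k \<in> K \<Longrightarrow> coord k x = 0"
  shows "x = 0"
  by (subst coord_expand[of x]) (simp add: assms)

text \<open>The real and imaginary parts of a complex eigenvector satisfy, in each coordinate, a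
  homogeneous 2 by 2 system with determinant \<open>?d\<close>. It is nonzero unless
  \<open>z\<close> equals \<open>l k\<close>, so any other \<open>z\<close> forces the eigenvector
  to vanish.\<close>

lemma spectrum_subset: "spectrum M \<subseteq> (\<lambda>k. complex_of_real (l k)) ` K"
proof
  fix z assume "z \<in> spectrum M"
  then obtain u where u: "u \<noteq> 0" "map_matrix complex_of_real M *v u = z *s u"
    by (auto simp: spectrum_def)
  define x y where "x = (\<chi> i. Re (u $ i))" and "y = (\<chi> i. Im (u $ i))"
  have comp: "(\<Sum>j\<in>UNIV. complex_of_real (M $ i $ j) * u $ j) = z * u $ i" for i
    using arg_cong[OF u(2), of "\<lambda>w. w $ i"]
    by (simp add: matrix_vector_mult_def map_matrix_def)
  have Mx: "M *v x = Re z *\<^sub>R x - Im z *\<^sub>R y"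
    using arg_cong[OF comp, of Re] by (simp add: vec_eq_iff matrix_vector_mult_def x_def y_def)
  have My: "M *v y = Re z *\<^sub>R y + Im z *\<^sub>R x"
    using arg_cong[OF comp, of Im] by (simp add: vec_eq_iff matrix_vector_mult_def x_def y_def)
  have x: "(l k - Re z) * coord k x = - Im z * coord k y" if "k \<in> K" for k
    using coord_mult[OF that, of x] unfolding Mx
    by (simp add: coord_linear algebra_simps)
  have y: "(l k - Re z) * coord k y = Im z * coord k x" if "k \<in> K" for k
    using coord_mult[OF that, of y] unfolding My
    by (simp add: coord_linear algebra_simps)
  show "z \<in> (\<lambda>k. complex_of_real (l k)) ` K"
  proof (rule ccontr)
    assume z: "z \<notin> (\<lambda>k. complex_of_real (l k)) ` K"
    have "coord k x = 0 \<and> coord k y = 0" if k: "k \<in> K" for k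
    proof -
      let ?d = "(l k - Re z)\<^sup>2 + (Im z)\<^sup>2"
      have "l k - Re z \<noteq> 0 \<or> Im z \<noteq> 0" using z k by (auto simp: complex_eq_iff image_iff)
      then have "?d \<noteq> 0" by (simp add: sum_power2_eq_zero_iff)
      moreover have "?d * coord k x = 0" "?d * coord k y = 0"
        using x[OF k] y[OF k] by algebra+
      ultimately show ?thesis by (metis mult_eq_0_iff)
    qed
    then have "x = 0" "y = 0" by (auto intro: coord_zero)
    then have "Re (u $ i) = 0" "Im (u $ i) = 0" for i
      unfolding x_def y_def by (simp_all add: vec_eq_iff)
    then have "u = 0" by (simp add: vec_eq_iff complex_eq_iff)
    with u(1) show False ..
  qed
qed

lemma invertible_shift:
  assumes "s \<notin> l ` K"
  shows "invertible (mat s - M)"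
proof -
  have "x = 0" if "(mat s - M) *v x = 0" for x
  proof -
    have "M *v x = s *\<^sub>R x" using that by (simp add: mat_vector_mult matrix_vector_mult_diff_rdistrib)
    then have "s * coord k x = l k * coord k x" if "k \<in> K" for k
      using coord_mult[OF that, of x] by (simp add: coord_linear)
    then have "coord k x = 0" if "k \<in> K" for k using assms that by auto
    then show ?thesis by (rule coord_zero)
  qed
  then show ?thesis unfolding invertible_left_inverse matrix_left_invertible_ker by blast
qed

section \<open>Free motions as combinations of modes, and their decay\<close>

lemma continuous_mode_solution:
  "((\<lambda>t. \<Sum>k\<in>K. (c k * exp (l k * t)) *\<^sub>R v k) has_vector_derivative
     M *v (\<Sum>k\<in>K. (c k * exp (l k * t)) *\<^sub>R v k)) (at t within S)"
proof -
  have "((\<lambda>t. (c k * exp (l k * t)) *\<^sub>R v k) has_vector_derivative (c k * exp (l k * t) * l k) *\<^sub>R v k)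
      (at t within S)" for k
    by (auto intro!: derivative_eq_intros simp: has_vector_derivative_def algebra_simps)
  then show ?thesis unfolding mult_combination by (intro has_vector_derivative_sum)
qed

text \<open>The integrating factor \<open>exp (- l k * t)\<close> turns the scalar equation of each
  coordinate into a vanishing derivative on the half-line, so the product keeps its value at
  0.\<close>

lemma continuous_modes:
  assumes "\<And>t. t \<ge> 0 \<Longrightarrow> (\<xi> has_vector_derivative M *v \<xi> t) (at t within {0..})"
  obtains c where "\<And>t. t \<ge> 0 \<Longrightarrow> \<xi> t = (\<Sum>k\<in>K. (c k * exp (l k * t)) *\<^sub>R v k)"
proof -
  define c where "c k = coord k (\<xi> 0)" for k
  have modes: "coord k (\<xi> t) = c k * exp (l k * t)" if k: "k \<in> K" and t: "t \<ge> 0" for k t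
  proof -
    have "((\<lambda>t. exp (- l k * t) * coord k (\<xi> t)) has_field_derivative 0) (at t within {0..})"
      if "t \<in> {0..}" for t
    proof -
      have "((\<lambda>t. coord k (\<xi> t)) has_vector_derivative coord k (M *v \<xi> t)) (at t within {0..})"
        using that
        by (intro bounded_linear.has_vector_derivative[OF coord(1)[unfolded linear_conv_bounded_linear]]
            assms) simp
      then have "((\<lambda>t. coord k (\<xi> t)) has_field_derivative l k * coord k (\<xi> t)) (at t within {0..})"
        by (simp add: has_real_derivative_iff_has_vector_derivative coord_mult k)
      then show ?thesis by (auto intro!: derivative_eq_intros)
    qed
    then obtain d where "\<And>t. t \<ge> 0 \<Longrightarrow> exp (- l k * t) * coord k (\<xi> t) = d"
      using has_field_derivative_zero_constant[of "{0..}" "\<lambda>t. exp (- l k * t) * coord k (\<xi> t)"]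
      by (auto simp: convex_real_interval)
    then have "exp (- l k * t) * coord k (\<xi> t) = exp (- l k * 0) * coord k (\<xi> 0)"
      using t by (metis order_refl)
    then show ?thesis by (simp add: c_def exp_minus field_simps)
  qed
  have "\<xi> t = (\<Sum>k\<in>K. (c k * exp (l k * t)) *\<^sub>R v k)" if "t \<ge> 0" for t
    by (subst coord_expand[of "\<xi> t"]) (simp add: modes that cong: sum.cong)
  then show thesis using that by blast
qed

lemma discrete_mode_solution:
  "(\<Sum>k\<in>K. (c k * l k ^ Suc t) *\<^sub>R v k) = M *v (\<Sum>k\<in>K. (c k * l k ^ t) *\<^sub>R v k)"
  by (simp add: mult_combination mult_ac)

lemma discrete_modes:
  assumes "\<And>t. \<xi> (Suc t) = M *v \<xi> t"
  obtains c where "\<And>t. \<xi> t = (\<Sum>k\<in>K. (c k * l k ^ t) *\<^sub>R v k)"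
proof -
  have "\<xi> t = (\<Sum>k\<in>K. (coord k (\<xi> 0) * l k ^ t) *\<^sub>R v k)" for t
  proof (induction t)
    case 0
    show ?case by (subst coord_expand[of "\<xi> 0"]) simp
  next
    case (Suc t)
    show ?case unfolding assms Suc.IH discrete_mode_solution ..
  qed
  then show thesis by (rule that)
qed

lemma continuous_decay:
  assumes "\<And>k. k \<in> K \<Longrightarrow> l k < 0"
    and "\<And>t. t \<ge> 0 \<Longrightarrow> (\<xi> has_vector_derivative M *v \<xi> t) (at t within {0..})"
  shows "(\<xi> \<longlongrightarrow> 0) at_top"
proof -
  obtain c where c: "\<And>t. t \<ge> 0 \<Longrightarrow> \<xi> t = (\<Sum>k\<in>K. (c k * exp (l k * t)) *\<^sub>R v k)"
    using continuous_modes assms(2) by blast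
  have "((\<lambda>t. exp (l k * t)) \<longlongrightarrow> 0) at_top" if "k \<in> K" for k
    using assms(1)[OF that]
    by (intro filterlim_compose[OF exp_at_bot] filterlim_tendsto_neg_mult_at_bot[OF tendsto_const] filterlim_ident)
  then have "((\<lambda>t. \<Sum>k\<in>K. (c k * exp (l k * t)) *\<^sub>R v k) \<longlongrightarrow> (\<Sum>k\<in>K. (c k * 0) *\<^sub>R v k)) at_top"
    by (intro tendsto_sum tendsto_scaleR tendsto_mult tendsto_const)
  then have "((\<lambda>t. \<Sum>k\<in>K. (c k * exp (l k * t)) *\<^sub>R v k) \<longlongrightarrow> 0) at_top" by simp
  \<comment> \<open>The modal formula is known only for nonnegative times.\<close>
  moreover have "eventually (\<lambda>t. (\<Sum>k\<in>K. (c k * exp (l k * t)) *\<^sub>R v k) = \<xi> t) at_top"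
    using eventually_ge_at_top[of 0] by eventually_elim (simp add: c)
  ultimately show ?thesis by (rule Lim_transform_eventually)
qed

lemma discrete_decay:
  assumes "\<And>k. k \<in> K \<Longrightarrow> \<bar>l k\<bar> < 1" and "\<And>t. \<xi> (Suc t) = M *v \<xi> t"
  shows "\<xi> \<longlonglongrightarrow> 0"
proof -
  obtain c where c: "\<And>t. \<xi> t = (\<Sum>k\<in>K. (c k * l k ^ t) *\<^sub>R v k)"
    using discrete_modes assms(2) by blast
  have "(\<lambda>t. l k ^ t) \<longlonglongrightarrow> 0" if "k \<in> K" for k
    using assms(1)[OF that] by (intro LIMSEQ_power_zero) simp
  then have "(\<lambda>t. \<Sum>k\<in>K. (c k * l k ^ t) *\<^sub>R v k) \<longlonglongrightarrow> (\<Sum>k\<in>K. (c k * 0) *\<^sub>R v k)"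
    by (intro tendsto_sum tendsto_scaleR tendsto_mult tendsto_const)
  then show ?thesis by (simp add: c[abs_def])
qed

end

subsection \<open>Static gain and tracking\<close>

text \<open>The factor by which the derivative or the shift acts on constant signals, and the point
  at which the standing assumptions exclude an invariant zero. It lets both time domains share one
  formula for the gain.\<close>

definition steady_point :: "time_domain \<Rightarrow> real" where
  "steady_point td = (case td of Continuous \<Rightarrow> 0 | Discrete \<Rightarrow> 1)"

lemma matrix_inv:
  assumes "invertible M"
  shows "M ** matrix_inv M = mat 1" and "matrix_inv M ** M = mat 1"
proof -
  have "M ** matrix_inv M = mat 1 \<and> matrix_inv M ** M = mat 1"
    using assms unfolding invertible_def matrix_inv_def by (rule someI_ex)
  then show "M ** matrix_inv M = mat 1" "matrix_inv M ** M = mat 1" by auto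
qed

lemma static_gain_steady_point:
  "static_gain td M B N D = N ** matrix_inv (mat (steady_point td) - M) ** B + D"
  by (cases td) (simp_all add: static_gain_def steady_point_def)

text \<open>The static gain is a Schur complement of the closed-loop pencil at the steady point, and
  feedback only adds columns of the pencil to other columns. A left null vector of the gain thus
  extends to one of the open-loop pencil, where full row rank kills it.\<close>

lemma static_gain_right_inverse:
  fixes A :: "real^'n^'n" and B :: "real^'m^'n" and C :: "real^'n^'p" and D :: "real^'m^'p"
    and F :: "real^'n^'m"
  assumes rk: "rank (eval_pencil (system_pencil A B C D) (complex_of_real (steady_point td))) = CARD('n + 'p)"
    and inv: "invertible (mat (steady_point td) - (A + B ** F))"
  obtains G :: "real^'p^'m"
  where "static_gain td (A + B ** F) B (C + D ** F) D ** G = mat 1"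
proof -
  let ?S = "static_gain td (A + B ** F) B (C + D ** F) D"
  let ?K = "mat (steady_point td) - (A + B ** F)"
  have "y = 0" if y: "transpose ?S *v y = 0" for y
  proof -
    \<comment> \<open>Chosen so that the state columns of the closed-loop pencil are
      annihilated.\<close>
    define x where "x = y v* (C + D ** F) v* matrix_inv ?K"
    have xK: "x v* ?K = y v* (C + D ** F)"
      by (simp add: x_def vector_matrix_mul_assoc matrix_inv[OF inv] flip: matrix_mul_assoc)
    have xB: "x v* B + y v* D = 0"
    proof -
      have "x v* B + y v* D = y v* ?S"
        unfolding static_gain_steady_point vector_matrix_mult_add_rdistrib
        unfolding x_def by (simp only: vector_matrix_mul_assoc)
      then show ?thesis using y by simp
    qed
    \<comment> \<open>Subtracting \<open>F\<close> times the input columns undoes the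
      feedback.\<close>
    have "x v* (A - mat (steady_point td)) + y v* C
        = (y v* (C + D ** F) - x v* ?K) - (x v* B + y v* D) v* F"
      by (simp add: vector_matrix_mult_add_rdistrib vector_matrix_mult_diff_rdistrib
          vector_matrix_left_distrib vector_matrix_mul_assoc)
    then have "x v* (A - mat (steady_point td)) + y v* C = 0" by (simp add: xK xB)
    then show ?thesis using xB by (rule system_pencil_left_kernel[OF rk])
  qed
  then have "\<exists>G. G ** transpose ?S = mat 1" by (simp add: matrix_left_invertible_ker)
  then obtain G where "?S ** G = mat 1" by (auto simp: left_invertible_transpose)
  then show thesis using that by blast
qed

text \<open>Relative to the equilibrium \<open>xbar r\<close> the closed loop moves freely and
  decays, while the output at the equilibrium is \<open>r\<close> because \<open>G\<close> is a
  right inverse of the gain.\<close>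

lemma (in real_eigenbasis) tracks:
  fixes A :: "real^'n^'n" and B :: "real^'m^'n" and C :: "real^'n^'p" and D :: "real^'m^'p"
  assumes M: "M = A + B ** F"
    and stable: "\<And>k. k \<in> K \<Longrightarrow> complex_of_real (l k) \<in> stab_region td"
    and G: "static_gain td M B (C + D ** F) D ** G = mat 1"
    and inv: "invertible (mat (steady_point td) - M)"
  shows "tracks_constant_references td A B C D F G"
proof -
  define xbar where "xbar r = matrix_inv (mat (steady_point td) - M) *v (B *v (G *v r))" for r
  have "(mat (steady_point td) - M) *v xbar r = B *v (G *v r)" for r
    by (simp add: xbar_def matrix_vector_mul_assoc matrix_mul_assoc matrix_inv[OF inv])
  then have xbar: "B *v (G *v r) = steady_point td *\<^sub>R xbar r - M *v xbar r" for r
    by (simp add: matrix_vector_mult_diff_rdistrib mat_vector_mult)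
  have gain: "(C + D ** F) *v xbar r + D *v (G *v r) = r" for r
  proof -
    have "(C + D ** F) *v xbar r + D *v (G *v r) = (static_gain td M B (C + D ** F) D ** G) *v r"
      unfolding static_gain_steady_point xbar_def matrix_vector_mul_assoc[symmetric]
        matrix_vector_mult_add_rdistrib ..
    then show ?thesis by (simp add: G)
  qed
  have out: "C *v x + D *v (F *v x + G *v r) = (C + D ** F) *v (x - xbar r) + r" for x r
    using gain[of r]
    by (simp add: matrix_vector_mult_diff_distrib matrix_vector_mult_add_rdistrib
        matrix_vector_right_distrib matrix_vector_mul_assoc algebra_simps)
  have dyn: "A *v x + B *v (F *v x + G *v r) = M *v x + B *v (G *v r)" for x r
    by (simp add: M matrix_vector_mult_add_rdistrib matrix_vector_right_distrib matrix_vector_mul_assoc)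
  \<comment> \<open>An arbitrary filter \<open>X\<close> serves real and integer time alike.\<close>
  have lim: "((\<lambda>t. (C + D ** F) *v \<xi> t + r) \<longlongrightarrow> r) X" if "(\<xi> \<longlongrightarrow> 0) X" for \<xi> r and X :: "'t filter"
    using tendsto_add[OF bounded_linear.tendsto[OF matrix_vector_mul_bounded_linear that] tendsto_const[of r]]
    by simp
  show ?thesis
  proof (cases td)
    case Continuous
    have "((\<lambda>t. C *v x t + D *v u t) \<longlongrightarrow> r) at_top"
      if u: "\<forall>t. u t = F *v x t + G *v r" and x: "ct_trajectory A B u x" for r x u
    proof -
      have eq: "M *v x t + B *v (G *v r) = M *v (x t - xbar r)" for t
        by (simp add: xbar Continuous steady_point_def matrix_vector_mult_diff_distrib)
      have "(x has_vector_derivative M *v (x t - xbar r)) (at t within {0..})" if "t \<ge> 0" for t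
        using x that by (simp add: ct_trajectory_def u dyn eq)
      then have "((\<lambda>t. x t - xbar r) has_vector_derivative M *v (x t - xbar r)) (at t within {0..})"
        if "t \<ge> 0" for t
        using that by (simp add: has_vector_derivative_diff_const)
      then have "((\<lambda>t. x t - xbar r) \<longlongrightarrow> 0) at_top"
        using stable by (intro continuous_decay) (auto simp: Continuous stab_region_def)
      then show ?thesis using lim by (simp add: u out)
    qed
    then show ?thesis by (auto simp: tracks_constant_references_def Continuous)
  next
    case Discrete
    have "(\<lambda>t. C *v x t + D *v u t) \<longlonglongrightarrow> r"
      if u: "\<forall>t. u t = F *v x t + G *v r" and x: "dt_trajectory A B u x" for r x u
    proof -
      have eq: "M *v x t + B *v (G *v r) - xbar r = M *v (x t - xbar r)" for t
        by (simp add: xbar Discrete steady_point_def matrix_vector_mult_diff_distrib)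
      have "x (Suc t) - xbar r = M *v (x t - xbar r)" for t
        using x by (simp add: dt_trajectory_def u dyn eq)
      then have "(\<lambda>t. x t - xbar r) \<longlonglongrightarrow> 0"
        using stable by (intro discrete_decay) (auto simp: Discrete stab_region_def)
      then show ?thesis using lim by (simp add: u out)
    qed
    then show ?thesis by (auto simp: tracks_constant_references_def Discrete)
  qed
qed

subsection \<open>Decoupling\<close>

text \<open>Each eigenvector of group \<open>Some i\<close> is sent along the i-th axis and group
  \<open>None\<close> to zero, so component \<open>q\<close> sees the coefficients of group
  \<open>q\<close> alone.\<close>

lemma output_modes:
  fixes N :: "real^'n^'p"
  assumes "\<And>j. (None, j) \<in> mode_index \<nu> \<Longrightarrow> N *v v None j = 0"
    and "\<And>i j. (Some i, j) \<in> mode_index \<nu> \<Longrightarrow> N *v v (Some i) j = \<delta> i j *\<^sub>R axis i 1"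
  shows "(N *v (\<Sum>k\<in>mode_index \<nu>. a k *\<^sub>R (\<lambda>(i, j). v i j) k)) $ q
    = (\<Sum>j = 1..\<nu> (Some q). a (Some q, j) * \<delta> q j)"
proof -
  have "N *v (\<Sum>k\<in>mode_index \<nu>. a k *\<^sub>R (\<lambda>(i, j). v i j) k)
      = (\<Sum>k\<in>mode_index \<nu>. a k *\<^sub>R (N *v (\<lambda>(i, j). v i j) k))"
    by (simp add: linear_sum[OF matrix_vector_mul_linear] matrix_vector_mult_scaleR)
  also have "\<dots> = (\<Sum>j = 1..\<nu> None. 0) +
      (\<Sum>i\<in>UNIV. \<Sum>j = 1..\<nu> (Some i). (a (Some i, j) * \<delta> i j) *\<^sub>R axis i 1)"
    unfolding sum_mode_index
    by (intro arg_cong2[where f = "(+)"] sum.cong) (simp_all add: assms mode_index_def)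
  finally have "(N *v (\<Sum>k\<in>mode_index \<nu>. a k *\<^sub>R (\<lambda>(i, j). v i j) k)) $ q
      = (\<Sum>i\<in>UNIV. \<Sum>j = 1..\<nu> (Some i). a (Some i, j) * \<delta> i j * axis i 1 $ q)"
    by (simp add: sum_component)
  also have "\<dots> = (\<Sum>i\<in>UNIV. if i = q then \<Sum>j = 1..\<nu> (Some i). a (Some i, j) * \<delta> i j else 0)"
    by (intro sum.cong) (auto simp: axis_def)
  finally show ?thesis by simp
qed

text \<open>Free motions are modal sums in the eigenbasis. The output multiplies each observable
  coefficient by its nonzero \<open>\<delta> i j\<close>, and dividing by it realizes every
  prescribed \<beta>.\<close>

lemma decoupling_eigenbasis_imp_decoupled_error_modes:
  fixes M :: "real^'n^'n" and N :: "real^'n^'p"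
  assumes "decoupling_eigenbasis M N \<nu> lam v"
  shows "decoupled_error_modes td M N \<nu> lam"
proof -
  interpret real_eigenbasis M "mode_index \<nu>" "\<lambda>(i, j). v i j" "\<lambda>(i, j). lam i j"
    using assms unfolding decoupling_eigenbasis_def by unfold_locales (auto simp: finite_mode_index)
  from assms obtain \<delta> where \<delta>: "\<And>i j. (Some i, j) \<in> mode_index \<nu> \<Longrightarrow>
      \<delta> i j \<noteq> 0 \<and> N *v v (Some i) j = \<delta> i j *\<^sub>R axis i 1"
    unfolding decoupling_eigenbasis_def by metis
  have modes: "(N *v (\<Sum>k\<in>mode_index \<nu>. a k *\<^sub>R (\<lambda>(i, j). v i j) k)) $ q
      = (\<Sum>j = 1..\<nu> (Some q). a (Some q, j) * \<delta> q j)" for a q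
    using assms \<delta> by (intro output_modes) (auto simp: decoupling_eigenbasis_def)
  \<comment> \<open>The unobservable modes do not reach the output; 0 is an arbitrary choice for
    them.\<close>
  define c :: "('p \<Rightarrow> nat \<Rightarrow> real) \<Rightarrow> 'p option \<times> nat \<Rightarrow> real"
    where "c \<beta> k = (case k of (None, j) \<Rightarrow> 0 | (Some i, j) \<Rightarrow> \<beta> i j / \<delta> i j)" for \<beta> k
  have c: "c \<beta> (Some i, j) * x * \<delta> i j = \<beta> i j * x" if "j \<in> {1..\<nu> (Some i)}" for \<beta> i j x
    using \<delta>[of i j] that by (simp add: c_def mode_index_def)
  show ?thesis
  proof (cases td)
    case Continuous
    have "\<exists>\<beta>. \<forall>i. \<forall>t\<ge>0. (N *v \<xi> t) $ i = (\<Sum>j = 1..\<nu> (Some i). \<beta> i j * exp (lam (Some i) j * t))"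
      if free: "\<forall>t\<ge>0. (\<xi> has_vector_derivative M *v \<xi> t) (at t within {0..})" for \<xi>
    proof -
      obtain a where "\<And>t. t \<ge> 0 \<Longrightarrow> \<xi> t
          = (\<Sum>k\<in>mode_index \<nu>. (a k * exp ((\<lambda>(i, j). lam i j) k * t)) *\<^sub>R (\<lambda>(i, j). v i j) k)"
        using continuous_modes[of \<xi>] free by blast
      then show ?thesis
        by (intro exI[of _ "\<lambda>i j. a (Some i, j) * \<delta> i j"]) (simp add: modes mult_ac)
    qed
    moreover have "\<exists>\<xi>. (\<forall>t\<ge>0. (\<xi> has_vector_derivative M *v \<xi> t) (at t within {0..})) \<and>
        (\<forall>i. \<forall>t\<ge>0. (N *v \<xi> t) $ i = (\<Sum>j = 1..\<nu> (Some i). \<beta> i j * exp (lam (Some i) j * t)))" for \<beta>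
      by (intro exI[of _ "\<lambda>t. \<Sum>k\<in>mode_index \<nu>.
            (c \<beta> k * exp ((\<lambda>(i, j). lam i j) k * t)) *\<^sub>R (\<lambda>(i, j). v i j) k"] conjI allI impI
          continuous_mode_solution)
        (simp only: modes, intro sum.cong, simp_all add: c)
    ultimately show ?thesis by (simp add: decoupled_error_modes_def Continuous Let_def)
  next
    case Discrete
    have "\<exists>\<beta>. \<forall>i t. (N *v \<xi> t) $ i = (\<Sum>j = 1..\<nu> (Some i). \<beta> i j * lam (Some i) j ^ t)"
      if free: "\<forall>t. \<xi> (Suc t) = M *v \<xi> t" for \<xi>
    proof -
      obtain a where "\<And>t. \<xi> t
          = (\<Sum>k\<in>mode_index \<nu>. (a k * (\<lambda>(i, j). lam i j) k ^ t) *\<^sub>R (\<lambda>(i, j). v i j) k)"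
        using discrete_modes[of \<xi>] free by blast
      then show ?thesis
        by (intro exI[of _ "\<lambda>i j. a (Some i, j) * \<delta> i j"]) (simp add: modes mult_ac)
    qed
    moreover have "\<exists>\<xi>. (\<forall>t. \<xi> (Suc t) = M *v \<xi> t) \<and>
        (\<forall>i t. (N *v \<xi> t) $ i = (\<Sum>j = 1..\<nu> (Some i). \<beta> i j * lam (Some i) j ^ t))" for \<beta>
      by (intro exI[of _ "\<lambda>t. \<Sum>k\<in>mode_index \<nu>.
            (c \<beta> k * (\<lambda>(i, j). lam i j) k ^ t) *\<^sub>R (\<lambda>(i, j). v i j) k"] conjI allI
          discrete_mode_solution)
        (simp only: modes, intro sum.cong, simp_all add: c)
    ultimately show ?thesis by (simp add: decoupled_error_modes_def Discrete Let_def)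
  qed
qed

section \<open>Passing between decoupling eigenvectors and members of \<open>R_hat\<close>\<close>

lemma R_hat_eigenvector:
  assumes "v \<in> R_hat A B C D i l"
  shows "\<exists>w. A *v v + B *v w = l *\<^sub>R v \<and> (i = None \<longrightarrow> C *v v + D *v w = 0) \<and>
    (\<forall>q. i = Some q \<longrightarrow> (\<exists>\<delta>. \<delta> \<noteq> 0 \<and> C *v v + D *v w = \<delta> *\<^sub>R axis q 1))"
proof -
  have "(A - mat l) *v v + B *v w = (A *v v + B *v w) - l *\<^sub>R v" for w
    by (simp add: matrix_vector_mult_diff_rdistrib mat_vector_mult)
  then have eq: "(A - mat l) *v v + B *v w = 0 \<longleftrightarrow> A *v v + B *v w = l *\<^sub>R v" for w
    by (simp only: right_minus_eq)
  show ?thesis using assms by (cases i) (auto simp: R_hat_def R_set_def eq)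
qed

text \<open>The input direction demanded by \<open>R_hat\<close> is the feedback \<open>F\<close>
  applied to the eigenvector.\<close>

lemma eigenvector_in_R_hat:
  assumes "decoupling_eigenbasis (A + B ** F) (C + D ** F) \<nu> lam v" and "(i, j) \<in> mode_index \<nu>"
  shows "v i j \<in> R_hat A B C D i (lam i j)"
proof -
  have "(A + B ** F) *v v i j = lam i j *\<^sub>R v i j"
    using assms unfolding decoupling_eigenbasis_def by blast
  then have 1: "(A - mat (lam i j)) *v v i j + B *v (F *v v i j) = 0"
    by (simp add: matrix_vector_mult_diff_rdistrib matrix_vector_mult_add_rdistrib mat_vector_mult
        matrix_vector_mul_assoc algebra_simps)
  have out: "C *v v i j + D *v (F *v v i j) = (C + D ** F) *v v i j"
    by (simp add: matrix_vector_mult_add_rdistrib matrix_vector_mul_assoc)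
  show ?thesis
  proof (cases i)
    case None
    then have "(C + D ** F) *v v i j = 0"
      using assms unfolding decoupling_eigenbasis_def by blast
    then show ?thesis using 1 out None by (auto simp: R_hat_def R_set_def)
  next
    case (Some q)
    then obtain \<delta> where "\<delta> \<noteq> 0" "(C + D ** F) *v v i j = \<delta> *\<^sub>R axis q 1"
      using assms unfolding decoupling_eigenbasis_def by blast
    then show ?thesis using 1 out Some by (auto simp: R_hat_def)
  qed
qed

lemma feedback_from_transversal:
  fixes A :: "real^'n^'n" and B :: "real^'m^'n" and C :: "real^'n^'p" and D :: "real^'m^'p"
  assumes mem: "\<And>i j. (i, j) \<in> mode_index \<nu> \<Longrightarrow> v i j \<in> R_hat A B C D i (lam i j)"
    and inj: "inj_on (\<lambda>(i, j). v i j) (mode_index \<nu>)"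
    and ind: "independent ((\<lambda>(i, j). v i j) ` mode_index \<nu>)"
    and card: "card (mode_index \<nu>) = CARD('n)"
  obtains F :: "real^'n^'m" where "decoupling_eigenbasis (A + B ** F) (C + D ** F) \<nu> lam v"
proof -
  let ?v = "\<lambda>(i, j). v i j"
  have "\<exists>w. A *v v i j + B *v w = lam i j *\<^sub>R v i j \<and> (i = None \<longrightarrow> C *v v i j + D *v w = 0) \<and>
      (\<forall>q. i = Some q \<longrightarrow> (\<exists>\<delta>. \<delta> \<noteq> 0 \<and> C *v v i j + D *v w = \<delta> *\<^sub>R axis q 1))"
    if "(i, j) \<in> mode_index \<nu>" for i j
    by (rule R_hat_eigenvector) (rule mem[OF that])
  then obtain w where w: "\<And>i j. (i, j) \<in> mode_index \<nu> \<Longrightarrow>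
      A *v v i j + B *v w i j = lam i j *\<^sub>R v i j \<and> (i = None \<longrightarrow> C *v v i j + D *v w i j = 0) \<and>
      (\<forall>q. i = Some q \<longrightarrow> (\<exists>\<delta>. \<delta> \<noteq> 0 \<and> C *v v i j + D *v w i j = \<delta> *\<^sub>R axis q 1))"
    by metis
  \<comment> \<open>Linear extension starts from a function of vectors; injectivity lets
    \<open>inv_into\<close> recover the index and with it the input direction.\<close>
  obtain g where g: "linear g"
      "\<forall>x\<in>?v ` mode_index \<nu>. g x = (\<lambda>(i, j). w i j) (inv_into (mode_index \<nu>) ?v x)"
    using linear_independent_extend[OF ind,
        of "\<lambda>x. (\<lambda>(i, j). w i j) (inv_into (mode_index \<nu>) ?v x)"] by (elim exE conjE)
  define F :: "real^'n^'m" where "F = matrix g"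
  have F: "F *v v i j = w i j" if "(i, j) \<in> mode_index \<nu>" for i j
  proof -
    have "F *v v i j = g (?v (i, j))" by (simp add: F_def matrix_works g(1))
    also have "\<dots> = (\<lambda>(i, j). w i j) (inv_into (mode_index \<nu>) ?v (?v (i, j)))"
      by (rule bspec[OF g(2)]) (rule imageI[OF that])
    also have "\<dots> = w i j" unfolding inv_into_f_f[OF inj that] by simp
    finally show ?thesis .
  qed
  \<comment> \<open>There are as many independent vectors as state dimensions, so they span.\<close>
  have "dim (?v ` mode_index \<nu>) = DIM(real^'n)"
    by (simp add: dim_eq_card_independent[OF ind] card_image[OF inj] card)
  then have span: "span (?v ` mode_index \<nu>) = UNIV" by (simp only: dim_eq_full)
  have "decoupling_eigenbasis (A + B ** F) (C + D ** F) \<nu> lam v"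
    unfolding decoupling_eigenbasis_def
    using inj ind span w
    by (auto simp: matrix_vector_mult_add_rdistrib F simp flip: matrix_vector_mul_assoc)
  then show thesis by (rule that)
qed

theorem theorem14:
  fixes A :: "real^'n^'n" and B :: "real^'m^'n" and C :: "real^'n^'p" and D :: "real^'m^'p"
    and td :: time_domain
    and \<nu> :: "'p option \<Rightarrow> nat" and lam :: "'p option \<Rightarrow> nat \<Rightarrow> real"
  assumes "standing_assumptions td A B C D"
    and "(\<Sum>i\<in>UNIV. \<nu> (Some i)) \<le> CARD('n)"
    and "\<nu> None = CARD('n) - (\<Sum>i\<in>UNIV. \<nu> (Some i))"
    and "\<forall>(i, j) \<in> mode_index \<nu>. complex_of_real (lam i j) \<in> stab_region td"
  shows "problem_2A_solvable td A B C D \<nu> lam \<longleftrightarrow>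
     (\<forall>P \<in> Pow (mode_index \<nu>).
        dim (\<Sum>(i, j)\<in>P. span (R_hat A B C D i (lam i j))) \<ge> card P)"
proof -
  let ?R = "\<lambda>(i, j). R_hat A B C D i (lam i j)"
  have dim_sum: "dim (\<Sum>(i, j)\<in>P. span (R_hat A B C D i (lam i j))) = dim (\<Union>k\<in>P. ?R k)"
    if "P \<subseteq> mode_index \<nu>" for P
  proof -
    have "finite P" using that finite_mode_index by (rule finite_subset)
    then have "(\<Sum>(i, j)\<in>P. span (R_hat A B C D i (lam i j))) = span (\<Union>k\<in>P. ?R k)"
      by (simp add: case_prod_beta sum_span_eq_span_Union)
    then show ?thesis by simp
  qed
  have card: "card (mode_index \<nu>) = CARD('n)" using assms by (simp add: card_mode_index)
  have zero: "\<not> invariant_zero A B C D (complex_of_real (steady_point td))"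
    and ri: "right_invertible A B C D"
    using assms(1) by (cases td; simp add: standing_assumptions_def steady_point_def)+
  have "card P \<le> dim (\<Union>k\<in>P. ?R k)"
    if P: "P \<subseteq> mode_index \<nu>" and solvable: "problem_2A_solvable td A B C D \<nu> lam" for P
  proof -
    obtain F :: "real^'n^'m" and v where v: "decoupling_eigenbasis (A + B ** F) (C + D ** F) \<nu> lam v"
      using solvable unfolding problem_2A_solvable_def state_output_decoupled_def by blast
    let ?v = "\<lambda>(i, j). v i j"
    have "inj_on ?v (mode_index \<nu>)" "independent (?v ` mode_index \<nu>)"
      using v unfolding decoupling_eigenbasis_def by auto
    then have inj: "inj_on ?v P" and ind: "independent (?v ` P)"
      using P by (meson inj_on_subset independent_mono image_mono)+
    \<comment> \<open>Necessity: the eigenvectors indexed by \<open>P\<close> are independent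
      members of the union, one for each index.\<close>
    have "?v ` P \<subseteq> (\<Union>k\<in>P. ?R k)" using P eigenvector_in_R_hat[OF v] by fastforce
    then have "card (?v ` P) \<le> dim (\<Union>k\<in>P. ?R k)" using ind by (rule independent_card_le_dim)
    then show ?thesis using inj by (simp add: card_image)
  qed
  moreover have "problem_2A_solvable td A B C D \<nu> lam"
    if rank: "\<And>P. P \<subseteq> mode_index \<nu> \<Longrightarrow> card P \<le> dim (\<Union>k\<in>P. ?R k)"
  proof -
    \<comment> \<open>Sufficiency: Rado's theorem picks the prospective eigenvectors, one from each
      set.\<close>
    obtain u where u: "\<And>k. k \<in> mode_index \<nu> \<Longrightarrow> u k \<in> ?R k" "inj_on u (mode_index \<nu>)"
        "independent (u ` mode_index \<nu>)"
      using rado[of "mode_index \<nu>" ?R, OF finite_mode_index rank] by blast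
    define v where "v i j = u (i, j)" for i j
    have v: "(\<lambda>(i, j). v i j) = u" by (auto simp: v_def)
    obtain F :: "real^'n^'m" where F: "decoupling_eigenbasis (A + B ** F) (C + D ** F) \<nu> lam v"
      by (rule feedback_from_transversal[of \<nu> v A B C D lam, OF _ _ _ card])
        (use u in \<open>force simp: v v_def\<close>)+
    let ?M = "A + B ** F" and ?N = "C + D ** F"
    interpret real_eigenbasis ?M "mode_index \<nu>" "\<lambda>(i, j). v i j" "\<lambda>(i, j). lam i j"
      using F unfolding decoupling_eigenbasis_def by unfold_locales (auto simp: finite_mode_index)
    have stable: "complex_of_real ((\<lambda>(i, j). lam i j) k) \<in> stab_region td"
      if "k \<in> mode_index \<nu>" for k
      using assms(4) that by auto
    \<comment> \<open>0 and 1 lie on the boundary of the open region containing every assigned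
      eigenvalue, so the steady point is no closed-loop eigenvalue and the static gain is well
      defined.\<close>
    have "complex_of_real (steady_point td) \<notin> stab_region td"
      by (cases td) (simp_all add: steady_point_def stab_region_def)
    then have inv: "invertible (mat (steady_point td) - ?M)"
      using stable by (intro invertible_shift) auto
    obtain G :: "real^'p^'m" where G: "static_gain td ?M B ?N D ** G = mat 1"
      using static_gain_right_inverse[OF system_pencil_full_row_rank[OF ri zero] inv] .
    have "spectrum ?M \<subseteq> stab_region td" using spectrum_subset stable by blast
    moreover have "tracks_constant_references td A B C D F G"
      by (rule tracks[OF refl stable G inv])
    moreover have "state_output_decoupled td ?M ?N \<nu> lam"
      unfolding state_output_decoupled_def
      using F decoupling_eigenbasis_imp_decoupled_error_modes by blast
    ultimately show ?thesis using G unfolding problem_2A_solvable_def by blast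
  qed
  ultimately show ?thesis using dim_sum by (metis (no_types, lifting) Pow_iff)
qed

end
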